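(* Let $(\mathfrak{g},[~,~],[~,~]')$ be a compatible Lie algebra over a field of characteristic $0$ and let $(V,\rho,\rho')$ be a representation of it. A linear map $R:V\to\mathfrak{g}$ is a relative Rota-Baxter operator if and only if $R$ is a Maurer-Cartan element in the compatible graded Lie algebra $(s\mathfrak{a},\{\![~,~]\!\},\{\![~,~]\!\}')$, i.e. $\{\![R,R]\!\}=\{\![R,R]\!\}'=0$.
   Context: A compatible Lie algebra $(\mathfrak{g},[~,~],[~,~]')$ is a vector space with two Lie brackets such that $[[x,y]',z]+[[x,y],z]'=[[x,z]',y]+[[x,z],y]'+[x,[y,z]']+[x,[y,z]]'$ for all $x,y,z$. A representation of it is a triple $(V,\rho,\rho')$ with $(V,\rho)$ a representation of $(\mathfrak{g},[~,~])$, $(V,\rho')$ a representation of $(\mathfrak{g},[~,~]')$ and $\rho([x,y]')+\rho'([x,y])=[\rho(x),\rho'(y)]+[\rho'(x),\rho(y)]$ for $x,y\in\mathfrak{g}$. A relative Rota-Baxter operator is a linear map $R:V\to\mathfrak{g}$ with $[R(v),R(w)]=R(\rho(R(v))w-\rho(R(w))v)$ and $[R(v),R(w)]'=R(\rho'(R(v))w-\rho'(R(w))v)$ for all $v,w\in V$. For a vector space $U$, the Nijenhuis-Richardson bracket on $\oplus_{n\ge0}\mathrm{Hom}(\wedge^{n+1}U,U)$ (with $\mathrm{Hom}(\wedge^{n+1}U,U)$ in degree $n$) is $[f,g]_{\mathsf{NR}}=f\diamond g-(-1)^{mn}g\diamond f$ for $f\in\mathrm{Hom}(\wedge^{m+1}U,U)$,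 $g\in\mathrm{Hom}(\wedge^{n+1}U,U)$, where $(f\diamond g)(x_1,\dots,x_{m+n+1})=\sum_{\sigma\in Sh(n+1,m)}(-1)^\sigma f(g(x_{\sigma(1)},\dots,x_{\sigma(n+1)}),x_{\sigma(n+2)},\dots,x_{\sigma(m+n+1)})$, the sum being over $(n+1,m)$-shuffles. Take $U=\mathfrak{g}\oplus V$ and define $\triangle,\triangle'\in\mathrm{Hom}(\wedge^2(\mathfrak{g}\oplus V),\mathfrak{g}\oplus V)$ by $\triangle((x,u),(y,v))=([x,y],\rho(x)v-\rho(y)u)$ and $\triangle'((x,u),(y,v))=([x,y]',\rho'(x)v-\rho'(y)u)$. Let $\mathfrak{a}=\oplus_{n\ge0}\mathrm{Hom}(\wedge^{n+1}V,\mathfrak{g})$, regarded as a subspace of $\oplus_{n\ge0}\mathrm{Hom}(\wedge^{n+1}(\mathfrak{g}\oplus V),\mathfrak{g}\oplus V)$ by extending maps by zero; its suspension $s\mathfrak{a}$ has $(s\mathfrak{a})_n=\mathrm{Hom}(\wedge^nV,\mathfrak{g})$, $n\ge1$. For $P\in\mathrm{Hom}(\wedge^mV,\mathfrak{g})$, $Q\in\mathrm{Hom}(\wedge^nV,\mathfrak{g})$ put $$\{\![P,Q]\!\}=(-1)^m[[\triangle,P]_{\mathsf{NR}},Q]_{\mathsf{NR}},\qquad\{\![P,Q]\!\}'=(-1)^m[[\triangle',P]_{\mathsf{NR}},Q]_{\mathsf{NR}}.$$ These are two graded Lie brackets on $s\mathfrak{a}$ (whose sum is again a graded Lie bracket),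 making it a compatible graded Lie algebra; $R\in\mathrm{Hom}(V,\mathfrak{g})$ has degree $1$. *)

theory Defs
  imports "HOL-Analysis.Product_Vector" "HOL-Combinatorics.Permutations"
begin

section \<open>Compatible Lie algebras, representations, relative Rota-Baxter operators\<close>

definition bilinear_map ::
  "('k::field \<Rightarrow> 'a::ab_group_add \<Rightarrow> 'a) \<Rightarrow> ('k \<Rightarrow> 'b::ab_group_add \<Rightarrow> 'b) \<Rightarrow>
   ('k \<Rightarrow> 'c::ab_group_add \<Rightarrow> 'c) \<Rightarrow> ('a \<Rightarrow> 'b \<Rightarrow> 'c) \<Rightarrow> bool"
  where "bilinear_map s1 s2 s3 f \<longleftrightarrow>
    (\<forall>y. Vector_Spaces.linear s1 s3 (\<lambda>x. f x y)) \<and> (\<forall>x. Vector_Spaces.linear s2 s3 (f x))"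

locale lie_algebra = vector_space scale
  for scale :: "'k::field \<Rightarrow> 'g::ab_group_add \<Rightarrow> 'g" +
  fixes br :: "'g \<Rightarrow> 'g \<Rightarrow> 'g"
  assumes bilinear_br: "bilinear_map scale scale scale br"
    and br_self: "br x x = 0"
    and jacobi: "br x (br y z) + br y (br z x) + br z (br x y) = 0"

locale compatible_lie_algebra =
  lie1: lie_algebra scale br + lie2: lie_algebra scale br'
  for scale :: "'k::field \<Rightarrow> 'g::ab_group_add \<Rightarrow> 'g"
    and br br' :: "'g \<Rightarrow> 'g \<Rightarrow> 'g" +
  assumes compatible:
    "br (br' x y) z + br' (br x y) z =
     br (br' x z) y + br' (br x z) y + br x (br' y z) + br' x (br y z)"

locale lie_representation = lie_algebra sg br + V: vector_space sv
  for sg :: "'k::field \<Rightarrow> 'g::ab_group_add \<Rightarrow> 'g"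
    and br :: "'g \<Rightarrow> 'g \<Rightarrow> 'g"
    and sv :: "'k \<Rightarrow> 'v::ab_group_add \<Rightarrow> 'v" +
  fixes rho :: "'g \<Rightarrow> 'v \<Rightarrow> 'v"
  assumes bilinear_rho: "bilinear_map sg sv sv rho"
    and rho_br: "rho (br x y) v = rho x (rho y v) - rho y (rho x v)"

locale compatible_representation =
  rep1: lie_representation sg br sv rho + rep2: lie_representation sg br' sv rho'
  for sg :: "'k::field \<Rightarrow> 'g::ab_group_add \<Rightarrow> 'g"
    and br br' :: "'g \<Rightarrow> 'g \<Rightarrow> 'g"
    and sv :: "'k \<Rightarrow> 'v::ab_group_add \<Rightarrow> 'v"
    and rho rho' :: "'g \<Rightarrow> 'v \<Rightarrow> 'v" +
  assumes compatible_rho: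
    "rho (br' x y) v + rho' (br x y) v =
     (rho x (rho' y v) - rho' y (rho x v)) + (rho' x (rho y v) - rho y (rho' x v))"

definition relative_rota_baxter ::
  "('k::field \<Rightarrow> 'g::ab_group_add \<Rightarrow> 'g) \<Rightarrow> ('g \<Rightarrow> 'g \<Rightarrow> 'g) \<Rightarrow> ('g \<Rightarrow> 'g \<Rightarrow> 'g) \<Rightarrow>
   ('k \<Rightarrow> 'v::ab_group_add \<Rightarrow> 'v) \<Rightarrow> ('g \<Rightarrow> 'v \<Rightarrow> 'v) \<Rightarrow> ('g \<Rightarrow> 'v \<Rightarrow> 'v) \<Rightarrow> ('v \<Rightarrow> 'g) \<Rightarrow> bool"
  where "relative_rota_baxter sg br br' sv rho rho' R \<longleftrightarrow>
    Vector_Spaces.linear sv sg R \<and>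
    (\<forall>v w. br (R v) (R w) = R (rho (R v) w - rho (R w) v)) \<and>
    (\<forall>v w. br' (R v) (R w) = R (rho' (R v) w - rho' (R w) v))"

section \<open>Alternating maps and the Nijenhuis-Richardson bracket\<close>

text \<open>An element of \<open>Hom(\<wedge>\<^sup>n U, W)\<close> is an alternating \<open>n\<close>-linear map, taken as a function on
  argument lists that is \<open>0\<close> on lists of length other than \<open>n\<close>, so that equality of maps is equality
  of functions.\<close>

definition alternating_maps ::
  "('k::field \<Rightarrow> 'u::ab_group_add \<Rightarrow> 'u) \<Rightarrow> ('k \<Rightarrow> 'w::ab_group_add \<Rightarrow> 'w) \<Rightarrow> nat \<Rightarrow>
   ('u list \<Rightarrow> 'w) set"
  where "alternating_maps su sw n = {f.
    (\<forall>xs. length xs \<noteq> n \<longrightarrow> f xs = 0) \<and>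
    (\<forall>xs i. length xs = n \<and> i < n \<longrightarrow> Vector_Spaces.linear su sw (\<lambda>x. f (xs[i := x]))) \<and>
    (\<forall>xs i j. length xs = n \<and> i < j \<and> j < n \<and> xs ! i = xs ! j \<longrightarrow> f xs = 0)}"

text \<open>\<open>(p, q)\<close>-shuffles, as permutations of \<open>{0, \<dots>, p + q - 1}\<close>.\<close>

definition shuffle_perms :: "nat \<Rightarrow> nat \<Rightarrow> (nat \<Rightarrow> nat) set"
  where "shuffle_perms p q = {\<sigma>. \<sigma> permutes {..<p + q} \<and>
    strict_mono_on {..<p} \<sigma> \<and> strict_mono_on {p..<p + q} \<sigma>}"

text \<open>In the next two definitions \<open>m\<close> and \<open>n\<close> are the degrees of \<open>f\<close> and \<open>g\<close>, which therefore take
  \<open>m + 1\<close> and \<open>n + 1\<close> arguments.\<close>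

definition nr_circ ::
  "('k::field \<Rightarrow> 'u::ab_group_add \<Rightarrow> 'u) \<Rightarrow> nat \<Rightarrow> nat \<Rightarrow>
   ('u list \<Rightarrow> 'u) \<Rightarrow> ('u list \<Rightarrow> 'u) \<Rightarrow> 'u list \<Rightarrow> 'u"
  where "nr_circ s m n f g xs =
    (if length xs = m + n + 1 then
       \<Sum>\<sigma>\<in>shuffle_perms (n + 1) m. s (of_int (sign \<sigma>))
         (f (g (map (\<lambda>i. xs ! \<sigma> i) [0..<n + 1]) # map (\<lambda>i. xs ! \<sigma> i) [n + 1..<m + n + 1]))
     else 0)"

definition nr_bracket ::
  "('k::field \<Rightarrow> 'u::ab_group_add \<Rightarrow> 'u) \<Rightarrow> nat \<Rightarrow> nat \<Rightarrow>
   ('u list \<Rightarrow> 'u) \<Rightarrow> ('u list \<Rightarrow> 'u) \<Rightarrow> 'u list \<Rightarrow> 'u"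
  where "nr_bracket s m n f g xs =
    nr_circ s m n f g xs - s ((- 1) ^ (m * n)) (nr_circ s n m g f xs)"

section \<open>The compatible graded Lie algebra of a representation\<close>

definition semidirect ::
  "('g::ab_group_add \<Rightarrow> 'g \<Rightarrow> 'g) \<Rightarrow> ('g \<Rightarrow> 'v::ab_group_add \<Rightarrow> 'v) \<Rightarrow>
   ('g \<times> 'v) list \<Rightarrow> 'g \<times> 'v"
  where "semidirect br rho xs =
    (case xs of [(x, u), (y, v)] \<Rightarrow> (br x y, rho x v - rho y u) | _ \<Rightarrow> 0)"

definition extend_by_zero ::
  "('v::ab_group_add list \<Rightarrow> 'g::ab_group_add) \<Rightarrow> ('g \<times> 'v) list \<Rightarrow> 'g \<times> 'v"
  where "extend_by_zero P xs = (P (map snd xs), 0)"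

text \<open>The degree \<open>n\<close> part of \<open>s\<aa>\<close>, as a subspace of \<open>Hom(\<wedge>\<^sup>n(\<gg> \<oplus> V), \<gg> \<oplus> V)\<close>. The
  grading starts at \<open>n = 1\<close>.\<close>

definition suspended_maps ::
  "('k::field \<Rightarrow> 'g::ab_group_add \<Rightarrow> 'g) \<Rightarrow> ('k \<Rightarrow> 'v::ab_group_add \<Rightarrow> 'v) \<Rightarrow> nat \<Rightarrow>
   (('g \<times> 'v) list \<Rightarrow> 'g \<times> 'v) set"
  where "suspended_maps sg sv n =
    (if n \<ge> 1 then extend_by_zero ` alternating_maps sv sg n else {\<lambda>_. 0})"

text \<open>Here \<open>m, n \<ge> 1\<close> are the degrees of \<open>P\<close> and \<open>Q\<close> in \<open>s\<aa>\<close>; their degrees for the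
  Nijenhuis-Richardson bracket are one less, while \<open>D\<close> has degree \<open>1\<close> there.\<close>

definition derived_bracket ::
  "('k::field \<Rightarrow> 'u::ab_group_add \<Rightarrow> 'u) \<Rightarrow> ('u list \<Rightarrow> 'u) \<Rightarrow> nat \<Rightarrow> nat \<Rightarrow>
   ('u list \<Rightarrow> 'u) \<Rightarrow> ('u list \<Rightarrow> 'u) \<Rightarrow> 'u list \<Rightarrow> 'u"
  where "derived_bracket s D m n P Q xs =
    s ((- 1) ^ m) (nr_bracket s m (n - 1) (nr_bracket s 1 (m - 1) D P) Q xs)"

text \<open>\<open>A n\<close> is the degree \<open>n\<close> part of the graded space; \<open>b m n\<close> and \<open>b' m n\<close> are the brackets on
  \<open>A m \<times> A n\<close>.\<close>

definition maurer_cartan ::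
  "(nat \<Rightarrow> ('u list \<Rightarrow> 'u::ab_group_add) set) \<Rightarrow>
   (nat \<Rightarrow> nat \<Rightarrow> ('u list \<Rightarrow> 'u) \<Rightarrow> ('u list \<Rightarrow> 'u) \<Rightarrow> 'u list \<Rightarrow> 'u) \<Rightarrow>
   (nat \<Rightarrow> nat \<Rightarrow> ('u list \<Rightarrow> 'u) \<Rightarrow> ('u list \<Rightarrow> 'u) \<Rightarrow> 'u list \<Rightarrow> 'u) \<Rightarrow>
   ('u list \<Rightarrow> 'u) \<Rightarrow> bool"
  where "maurer_cartan A b b' P \<longleftrightarrow>
    P \<in> A 1 \<and> b 1 1 P P = (\<lambda>_. 0) \<and> b' 1 1 P P = (\<lambda>_. 0)"

text \<open>The identification of linear maps \<open>V \<rightarrow> \<gg>\<close> with \<open>Hom(\<wedge>\<^sup>1 V, \<gg>)\<close>.\<close>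

definition unary_map :: "('v \<Rightarrow> 'g::zero) \<Rightarrow> 'v list \<Rightarrow> 'g"
  where "unary_map R vs = (case vs of [v] \<Rightarrow> R v | _ \<Rightarrow> 0)"

end

theory Submission
  imports Defs
begin

text \<open>Write \<open>P\<close> for the extension by zero of \<open>R\<close> and \<open>D\<close> for the semidirect product bracket. As
  \<open>P \<circ> P = 0\<close> and \<open>D\<close> is skew-symmetric, the double bracket \<open>[[D, P], P](a, b)\<close> collapses to
  \<open>2 (D(Pa, Pb) - P (D(Pa, b) - D(Pb, a)))\<close>, which is twice the defect of the Rota-Baxter identity
  for the \<open>V\<close>-components of \<open>a\<close> and \<open>b\<close>. In characteristic \<open>0\<close> the factor \<open>2\<close> is harmless.\<close>

text \<open>Both blocks have length one, so monotonicity on them is vacuous and every permutation of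
  \<open>{0, 1}\<close> qualifies.\<close>

lemma shuffle_perms_1_1: "shuffle_perms (Suc 0) (Suc 0) = {id, Transposition.transpose 0 1}"
proof -
  have "{..<Suc 0 + Suc 0} = {0, 1 :: nat}"
    by auto
  then show ?thesis
    by (auto simp: shuffle_perms_def permutes_doubleton_iff strict_mono_on_def)
qed

text \<open>A single block covers \<open>{0, 1}\<close>, and the transposition is not increasing on
  it.\<close>

lemma shuffle_perms_2_0: "shuffle_perms (Suc (Suc 0)) 0 = {id}"
proof -
  have "{..<Suc (Suc 0)} = {0, 1 :: nat}"
    by auto
  moreover have "\<not> strict_mono_on {0, 1} (Transposition.transpose 0 (1 :: nat))"
    by (auto dest: strict_mono_onD[where r = 0 and s = 1])
  moreover have "strict_mono_on A id" for A :: "nat set"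
    by (simp add: strict_mono_on_def)
  ultimately show ?thesis
    by (auto simp: shuffle_perms_def permutes_doubleton_iff)
qed

text \<open>The first two terms come from the two (1,1)-shuffles, the last from the only
  (2,0)-shuffle; the sign \<open>(- 1) ^ (m * n)\<close> is 1 because \<open>P\<close> has degree 0.
  As \<open>F\<close> is arbitrary, the formula can be iterated with \<open>[D, P]\<close> in its
  place.\<close>

lemma (in vector_space) nr_bracket_unary:
  "nr_bracket scale (Suc 0) 0 F P [a, b] = F [P [a], b] - F [P [b], a] - P [F [a, b]]"
proof -
  have "id \<noteq> Transposition.transpose 0 (1 :: nat)"
    by (metis id_apply transpose_apply_first zero_neq_one)
  then show ?thesis
    by (simp add: nr_bracket_def nr_circ_def shuffle_perms_1_1 shuffle_perms_2_0 sign_swap_id)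
qed

lemma (in vector_space) nr_bracket_unary_length:
  "length xs \<noteq> 2 \<Longrightarrow> nr_bracket scale (Suc 0) 0 F P xs = 0"
  by (simp add: nr_bracket_def nr_circ_def)

lemma unary_map_alternating:
  assumes "Vector_Spaces.linear sv sg R"
  shows "unary_map R \<in> alternating_maps sv sg 1"
proof -
  have "Vector_Spaces.linear sv sg (\<lambda>x. unary_map R (xs[i := x]))"
    if "length xs = 1" "i < 1" for xs :: "'b list" and i
    using that assms by (auto simp: length_Suc_conv unary_map_def)
  then show ?thesis
    by (auto simp: alternating_maps_def unary_map_def split: list.splits)
qed

text \<open>Polarization of \<open>br_self\<close> at \<open>x + y\<close>.\<close>

lemma (in lie_algebra) br_skew: "br x y = - br y x"
proof -
  have add: "br (a + b) c = br a c + br b c" "br c (a + b) = br c a + br c b" for a b c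
    using bilinear_br unfolding bilinear_map_def Vector_Spaces.linear_iff by auto
  show ?thesis
    using br_self[of "x + y"] unfolding add
    by (simp add: br_self eq_neg_iff_add_eq_0 add.commute)
qed

lemma derived_bracket_unary_eq_0_iff:
  fixes sg :: "'k::field_char_0 \<Rightarrow> 'g::ab_group_add \<Rightarrow> 'g"
    and sv :: "'k \<Rightarrow> 'v::ab_group_add \<Rightarrow> 'v"
  assumes "lie_representation sg br sv rho" and "Vector_Spaces.linear sv sg R"
  shows "derived_bracket (module_prod.scale sg sv) (semidirect br rho) 1 1
      (extend_by_zero (unary_map R)) (extend_by_zero (unary_map R)) = (\<lambda>_. 0) \<longleftrightarrow>
    (\<forall>v w. br (R v) (R w) = R (rho (R v) w - rho (R w) v))"
    (is "derived_bracket ?s ?D 1 1 ?P ?P = _ \<longleftrightarrow> _")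
proof -
  interpret lie_representation sg br sv rho by fact
  interpret R: Vector_Spaces.linear sv sg R by fact
  interpret mp: vector_space_prod sg sv ..
  have br0: "br x 0 = 0" "br 0 x = 0" for x
    using bilinear_br unfolding bilinear_map_def
    by (metis module_hom.zero Vector_Spaces.linear_def)+
  have rho0: "rho x 0 = 0" "rho 0 v = 0" for x v
    using bilinear_rho unfolding bilinear_map_def
    by (metis module_hom.zero Vector_Spaces.linear_def)+
  define d where "d v w = br (R v) (R w) - R (rho (R v) w - rho (R w) v)" for v w
  have P: "?P [a] = (R (snd a), 0)" for a
    by (simp add: extend_by_zero_def unary_map_def)
  have D: "?D [a, b] = (br (fst a) (fst b), rho (fst a) (snd b) - rho (fst b) (snd a))" for a b
    by (simp add: semidirect_def split: prod.splits)
  have scale2: "sg 2 x = x + x" for x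
    using scale_left_distrib[of 1 1 x] by simp
  \<comment> \<open>The factor \<open>- 2\<close> is the 2 of the double bracket times the sign
    \<open>(- 1) ^ m\<close> with \<open>m = 1\<close>.\<close>
  have two: "derived_bracket ?s ?D 1 1 ?P ?P [a, b] = (sg (- 2) (d (snd a) (snd b)), 0)" for a b
    unfolding derived_bracket_def One_nat_def diff_self_eq_0 mp.p.nr_bracket_unary P D
    \<comment> \<open>The term \<open>D(Pb, Pa)\<close> becomes a second copy of
      \<open>D(Pa, Pb)\<close>.\<close>
    using br_skew[of "R (snd b)" "R (snd a)"]
    by (simp add: mp.scale_def d_def scale2 br0 rho0 R.diff R.neg)
  \<comment> \<open>Brackets are functions on lists of every length; this reduces their vanishing to
    pairs.\<close>
  have other: "derived_bracket ?s ?D 1 1 ?P ?P xs = 0" if "length xs \<noteq> 2" for xs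
    using that by (simp add: derived_bracket_def mp.p.nr_bracket_unary_length)
  have "derived_bracket ?s ?D 1 1 ?P ?P = (\<lambda>_. 0) \<longleftrightarrow> (\<forall>v w. d v w = 0)"
  proof
    assume 0: "derived_bracket ?s ?D 1 1 ?P ?P = (\<lambda>_. 0)"
    show "\<forall>v w. d v w = 0"
    proof (intro allI)
      fix v w
      show "d v w = 0"
        \<comment> \<open>Only the V-components enter \<open>two\<close>, so any lifts of
          \<open>v\<close> and \<open>w\<close> would do; \<open>- 2\<close> is nonzero in
          characteristic 0.\<close>
        using two[of "(0, v)" "(0, w)"] unfolding 0 by (simp add: zero_prod_def)
    qed
  next
    assume 0: "\<forall>v w. d v w = 0"
    show "derived_bracket ?s ?D 1 1 ?P ?P = (\<lambda>_. 0)"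
    proof
      fix xs :: "('g \<times> 'v) list"
      show "derived_bracket ?s ?D 1 1 ?P ?P xs = 0"
      proof (cases "length xs = 2")
        case True
        then obtain a b where "xs = [a, b]"
          by (auto simp: numeral_2_eq_2 length_Suc_conv)
        then show ?thesis
          unfolding \<open>xs = [a, b]\<close> two using 0 by (simp add: zero_prod_def)
      qed (rule other)
    qed
  qed
  then show ?thesis
    unfolding d_def right_minus_eq .
qed

theorem proposition4p13:
  fixes sg :: "'k::field_char_0 \<Rightarrow> 'g::ab_group_add \<Rightarrow> 'g"
    and sv :: "'k \<Rightarrow> 'v::ab_group_add \<Rightarrow> 'v"
    and br br' :: "'g \<Rightarrow> 'g \<Rightarrow> 'g"
    and rho rho' :: "'g \<Rightarrow> 'v \<Rightarrow> 'v"
    and R :: "'v \<Rightarrow> 'g"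
  assumes "compatible_lie_algebra sg br br'"
    and "compatible_representation sg br br' sv rho rho'"
    and "Vector_Spaces.linear sv sg R"
  shows "relative_rota_baxter sg br br' sv rho rho' R \<longleftrightarrow>
    maurer_cartan (suspended_maps sg sv)
      (derived_bracket (module_prod.scale sg sv) (semidirect br rho))
      (derived_bracket (module_prod.scale sg sv) (semidirect br' rho'))
      (extend_by_zero (unary_map R))"
proof -
  interpret compatible_representation sg br br' sv rho rho' by fact
  \<comment> \<open>Being Maurer-Cartan includes lying in degree 1; this is where linearity of
    \<open>R\<close> gives that part.\<close>
  have degree_1: "extend_by_zero (unary_map R) \<in> suspended_maps sg sv 1"
    using unary_map_alternating[OF assms(3)] by (simp add: suspended_maps_def)
  show ?thesis
    unfolding relative_rota_baxter_def maurer_cartan_def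
      derived_bracket_unary_eq_0_iff[OF rep1.lie_representation_axioms assms(3)]
      derived_bracket_unary_eq_0_iff[OF rep2.lie_representation_axioms assms(3)]
    by (simp only: assms(3) degree_1 simp_thms)
qed

end
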